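(* Let $G(\mathcal V,\mathcal E,\mathcal C)$ be a multicost network with $d$ cost criteria and consider a path skyline query from $s\in\mathcal V$ to $t\in\mathcal V$. Let $lb(s,t)$ be the vector computed for $s$ by the algorithm ParetoPrep (on input $s,t$, upon termination). Then for every cost dimension $i\in\{1,\dots,d\}$, $lb(s,t)_i$ is the cost value, with respect to dimension $i$, of the shortest path from $s$ to $t$ with respect to dimension $i$ in the original graph $G(\mathcal V,\mathcal E,\mathcal C)$.
   Context: A multicost network is a finite directed graph $G(\mathcal V,\mathcal E,\mathcal C)$ with $\mathcal E\subseteq\mathcal V\times\mathcal V$ in which each edge $(n,m)$ carries a cost vector $cost(n,m)\in\mathbb R_+^d$ (nonnegative entries). A path from $a$ to $b$ is a sequence of adjacent edges from $a$ to $b$ that visits no node twice; its cost in criterion $i$ is $cost(p)_i=\sum_{(n,m)\in p}cost(n,m)_i$. The trivial path (no edges) from a node to itself has cost $0$; if there is no path from $s$ to $t$, the shortest path cost is understood to be $\infty$. A vector $a$ dominates a vector $b$, written $a\prec_{\mathrm{dom}} b$, iff $a_i<b_i$ for some $i$ and there is no $j$ with $a_j>b_j$. For a set $A$ of paths and a vector $b$, $A\prec_{\mathrm{dom}} b$ means that $cost(a)\prec_{\mathrm{dom}} b$ for some $a\in A$. A path skyline query from $s$ to $t$ asks for the set of all paths from $s$ to $t$ whose cost vectors are not dominated by the cost vector of any path from $s$ to $t$. ParetoPrep (input $s,t$). Each node $n$ has a vector $lb(n,t)\in[0,\infty]^d$ and successor edges $succ_1(n),\dots,succ_d(n)$. Initially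 $lb(t,t)=0$, $lb(n,t)_i=\infty$ for all $n\ne t$ and all $i$, and all successors are undefined. Step 1: set $P:=\emptyset$ (a set of paths from $s$ to $t$) and $open:=\{t\}$. While $open\neq\emptyset$ repeat Steps 2-5: Step 2: choose $n\in open$ minimizing $\sum_{i=1}^d lb(n,t)_i$ (ties broken arbitrarily) and remove it from $open$. Step 3: if $P\prec_{\mathrm{dom}} lb(n,t)$, skip Steps 4 and 5 for this iteration. Step 4: for each incoming edge $(m,n)$ of $n$ and each criterion $i$: if $lb(n,t)_i+cost(m,n)_i<lb(m,t)_i$, then set $lb(m,t)_i:=lb(n,t)_i+cost(m,n)_i$, set $succ_i(m):=(m,n)$, and add $m$ to $open$. Step 5: for each component $i$ of $lb(s,t)$ modified in Step 4, let $p$ be the path obtained by starting at $s$ and repeatedly following the edges $succ_i(\cdot)$ until $t$ is reached; add $p$ to $P$ and remove from $P$ all paths dominated by $p$. When $open$ is empty, return $P$ and $lb$. *)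

theory Defs
  imports "HOL-Analysis.Finite_Cartesian_Product" "Graph_Theory.Graph_Theory"
begin

definition dominates :: "'a::ord ^ 'd \<Rightarrow> 'a ^ 'd \<Rightarrow> bool" where
  "dominates a b \<longleftrightarrow> (\<exists>i. a $ i < b $ i) \<and> \<not> (\<exists>j. a $ j > b $ j)"

text \<open>
  Vertices may be any elements of \<open>'v\<close>; the criteria are the elements of the
  finite type \<open>'d\<close>. Paths are lists of edges, as in the library on digraphs.
\<close>

record ('v, 'd) pp_state =
  pp_lb :: "'v \<Rightarrow> ereal ^ 'd"
  pp_succ :: "'d \<Rightarrow> 'v \<Rightarrow> ('v \<times> 'v) option"
  pp_paths :: "('v \<times> 'v) list set"
  pp_open :: "'v set"

text \<open>
  \<open>follows f m t p\<close>: starting at \<open>m\<close> and repeatedly following the edges \<open>f\<close> until \<open>t\<close> is reached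
  traverses exactly the edges \<open>p\<close>.
\<close>

inductive follows :: "('v \<Rightarrow> ('v \<times> 'v) option) \<Rightarrow> 'v \<Rightarrow> 'v \<Rightarrow> ('v \<times> 'v) list \<Rightarrow> bool"
  for f :: "'v \<Rightarrow> ('v \<times> 'v) option" where
  reached: "follows f t t []"
| follow_edge: "m \<noteq> t \<Longrightarrow> f m = Some e \<Longrightarrow> follows f (snd e) t p \<Longrightarrow> follows f m t (e # p)"

locale multicost_network = pair_fin_digraph G
  for G :: "'v pair_pre_digraph" +
  fixes cost :: "'v \<times> 'v \<Rightarrow> real ^ 'd"
  assumes cost_nonneg: "e \<in> parcs G \<Longrightarrow> 0 \<le> cost e $ i"
begin

definition path_cost :: "('v \<times> 'v) list \<Rightarrow> real ^ 'd" where
  "path_cost p = (\<chi> i. awalk_cost (\<lambda>e. cost e $ i) p)"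

definition shortest_path_cost :: "'v \<Rightarrow> 'v \<Rightarrow> 'd \<Rightarrow> ereal" where
  "shortest_path_cost s t i =
     (if {p. apath s p t} = {} then \<infinity>
      else ereal (Min ((\<lambda>p. path_cost p $ i) ` {p. apath s p t})))"

definition set_dominates :: "('v \<times> 'v) list set \<Rightarrow> ereal ^ 'd \<Rightarrow> bool" where
  "set_dominates P b \<longleftrightarrow> (\<exists>p\<in>P. dominates (\<chi> i. ereal (path_cost p $ i)) b)"

definition add_path :: "('v \<times> 'v) list \<Rightarrow> ('v \<times> 'v) list set \<Rightarrow> ('v \<times> 'v) list set" where
  "add_path p P = {q \<in> insert p P. \<not> dominates (path_cost p) (path_cost q)}"

definition pp_init :: "'v \<Rightarrow> ('v, 'd) pp_state" where
  "pp_init t =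
     \<lparr> pp_lb = (\<lambda>n. \<chi> i. if n = t then 0 else \<infinity>),
       pp_succ = (\<lambda>i n. None),
       pp_paths = {},
       pp_open = {t} \<rparr>"

definition selectable :: "('v, 'd) pp_state \<Rightarrow> 'v \<Rightarrow> bool" where
  "selectable \<sigma> n \<longleftrightarrow>
     n \<in> pp_open \<sigma> \<and> (\<forall>m\<in>pp_open \<sigma>. (\<Sum>i\<in>UNIV. pp_lb \<sigma> n $ i) \<le> (\<Sum>i\<in>UNIV. pp_lb \<sigma> m $ i))"

definition remove_open :: "'v \<Rightarrow> ('v, 'd) pp_state \<Rightarrow> ('v, 'd) pp_state" where
  "remove_open n \<sigma> = \<sigma>\<lparr> pp_open := pp_open \<sigma> - {n} \<rparr>"

definition improves :: "('v, 'd) pp_state \<Rightarrow> 'v \<Rightarrow> 'v \<Rightarrow> 'd \<Rightarrow> bool" where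
  "improves \<sigma> n m i \<longleftrightarrow>
     (m, n) \<in> parcs G \<and> pp_lb \<sigma> n $ i + ereal (cost (m, n) $ i) < pp_lb \<sigma> m $ i"

text \<open>
  The updates caused by the expansion of \<open>n\<close> are carried out simultaneously. This agrees with
  treating the incoming edges and the criteria one after the other, in any order: each entry
  \<open>lb(m,t)\<^sub>i\<close> is compared with only one edge \<open>(m,n)\<close>, and the entries of \<open>n\<close> itself, which are the
  only ones read by other updates, cannot change since costs are nonnegative.
\<close>

definition relax :: "'v \<Rightarrow> ('v, 'd) pp_state \<Rightarrow> ('v, 'd) pp_state" where
  "relax n \<sigma> = \<sigma>\<lparr>
     pp_lb := (\<lambda>m. \<chi> i. if improves \<sigma> n m i then pp_lb \<sigma> n $ i + ereal (cost (m, n) $ i)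
                        else pp_lb \<sigma> m $ i),
     pp_succ := (\<lambda>i m. if improves \<sigma> n m i then Some (m, n) else pp_succ \<sigma> i m),
     pp_open := pp_open \<sigma> \<union> {m. \<exists>i. improves \<sigma> n m i} \<rparr>"

text \<open>
  One iteration of the main loop. In \<open>expand\<close>, the list \<open>is\<close> enumerates, in an arbitrary order, the
  components of \<open>lb(s,t)\<close> modified by the expansion, and \<open>ps\<close> lists the corresponding paths; these
  are added one after the other.
\<close>

inductive pp_step :: "'v \<Rightarrow> 'v \<Rightarrow> ('v, 'd) pp_state \<Rightarrow> ('v, 'd) pp_state \<Rightarrow> bool"
  for s t :: 'v where
  prune:
    "selectable \<sigma> n \<Longrightarrow> set_dominates (pp_paths \<sigma>) (pp_lb \<sigma> n) \<Longrightarrow>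
     pp_step s t \<sigma> (remove_open n \<sigma>)"
| expand:
    "selectable \<sigma> n \<Longrightarrow> \<not> set_dominates (pp_paths \<sigma>) (pp_lb \<sigma> n) \<Longrightarrow>
     \<sigma>' = relax n (remove_open n \<sigma>) \<Longrightarrow>
     distinct is \<Longrightarrow> set is = {i. pp_lb \<sigma>' s $ i \<noteq> pp_lb \<sigma> s $ i} \<Longrightarrow>
     list_all2 (\<lambda>i p. follows (pp_succ \<sigma>' i) s t p) is ps \<Longrightarrow>
     pp_step s t \<sigma> (\<sigma>'\<lparr> pp_paths := fold add_path ps (pp_paths \<sigma>') \<rparr>)"

text \<open>
  \<open>ParetoPrep s t P lb\<close>: some terminating run on input \<open>s\<close>, \<open>t\<close> returns \<open>P\<close> and \<open>lb\<close>. As ties are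
  broken arbitrarily, this is a relation.
\<close>

definition ParetoPrep ::
  "'v \<Rightarrow> 'v \<Rightarrow> ('v \<times> 'v) list set \<Rightarrow> ('v \<Rightarrow> ereal ^ 'd) \<Rightarrow> bool" where
  "ParetoPrep s t P lb \<longleftrightarrow>
     (\<exists>\<sigma>. (pp_step s t)\<^sup>*\<^sup>* (pp_init t) \<sigma> \<and> pp_open \<sigma> = {} \<and> P = pp_paths \<sigma> \<and> lb = pp_lb \<sigma>)"

end

end

theory Submission
  imports Defs
begin

text \<open>
  Write \<open>P\<close> for the final path set. When the algorithm stops, every node \<open>n\<close> was either pruned, so
  that \<open>P\<close> dominates \<open>lb(n,t)\<close>, or all edges into \<open>n\<close> are relaxed; the former persists although paths
  are removed from \<open>P\<close>, since dominance is transitive. Going backwards along a walk \<open>w\<close> from \<open>s\<close> to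
  \<open>t\<close>, one meets no pruned node and gets \<open>lb(s,t) \<le> cost(w)\<close> in all criteria, or the pruned node next
  to \<open>t\<close> yields a path in \<open>P\<close> that dominates \<open>cost(w)\<close>. The latter is impossible for a minimal element
  of \<open>P\<close>, so \<open>lb(s,t)\<close> is a lower bound for the costs of \<open>P\<close>. The same argument for one criterion \<open>i\<close>
  and a walk \<open>w\<close> that is shortest for \<open>i\<close> then gives \<open>lb(s,t)\<^sub>i \<le> cost(w)\<^sub>i\<close> in both cases. Conversely,
  every finite \<open>lb(n,t)\<^sub>i\<close> is the cost of some walk.
\<close>

section \<open>Dominance, path sets and shortest path costs\<close>

lemma dominates_iff_less:
  fixes a b :: "'a::linorder ^ 'd"
  shows "dominates a b \<longleftrightarrow> a < b"
  by (auto simp: dominates_def less_vec_def less_eq_vec_def not_less not_le)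

context multicost_network
begin

lemma path_cost_simps [simp]:
  "path_cost [] = 0" "path_cost (e # p) = cost e + path_cost p"
  by (simp_all add: path_cost_def vec_eq_iff)

lemma set_dominates_iff:
  "set_dominates P b \<longleftrightarrow> (\<exists>p\<in>P. (\<chi> i. ereal (path_cost p $ i)) < b)"
  by (simp add: set_dominates_def dominates_iff_less)

lemma ereal_path_cost_mono:
  assumes "path_cost p < path_cost q"
  shows "(\<chi> i. ereal (path_cost p $ i)) < (\<chi> i. ereal (path_cost q $ i))"
  using assms by (auto simp: less_vec_def less_eq_vec_def)

text \<open>If inserting \<open>p\<close> removes the dominating path \<open>q\<close>, then
  \<open>p\<close> dominates \<open>q\<close> and takes over its role; \<open>p\<close> survives its
  own insertion because dominance is irreflexive.\<close>

lemma set_dominates_fold_add_path: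
  assumes "set_dominates P b"
  shows "set_dominates (fold add_path ps P) b"
  using assms
proof (induction ps arbitrary: P)
  case (Cons p ps)
  from Cons.prems obtain q where q: "q \<in> P" "(\<chi> i. ereal (path_cost q $ i)) < b"
    by (auto simp: set_dominates_iff)
  have "set_dominates (add_path p P) b"
  proof (cases "path_cost p < path_cost q")
    case True
    then have "(\<chi> i. ereal (path_cost p $ i)) < b"
      using ereal_path_cost_mono q(2) less_trans by blast
    then show ?thesis
      by (auto simp: set_dominates_iff add_path_def dominates_iff_less)
  next
    case False
    then show ?thesis
      using q by (auto simp: set_dominates_iff add_path_def dominates_iff_less)
  qed
  then show ?case
    using Cons.IH by simp
qed simp

lemma fold_add_path_subset: "fold add_path ps P \<subseteq> set ps \<union> P"
proof (induction ps arbitrary: P)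
  case (Cons p ps)
  have "add_path p P \<subseteq> insert p P"
    by (auto simp: add_path_def)
  then show ?case
    using Cons.IH[of "add_path p P"] by auto
qed simp

text \<open>Costs are nonnegative, so deleting the cycles of a walk raises no cost. Hence the
  algorithm can be analysed with walks, although shortest paths range over paths that visit no node
  twice.\<close>

lemma shortest_path_cost_eqI:
  assumes walk: "x = \<infinity> \<or> (\<exists>w. awalk s w t \<and> x = ereal (path_cost w $ i))"
    and le: "\<And>w. awalk s w t \<Longrightarrow> x \<le> ereal (path_cost w $ i)"
  shows "x = shortest_path_cost s t i"
proof (cases "x = \<infinity>")
  case True
  \<comment> \<open>Costs are real, so an infinite lower bound rules out every walk.\<close>
  then have "{p. apath s p t} = {}"
    using le by (auto simp: apath_def)
  then show ?thesis
    using True by (simp add: shortest_path_cost_def)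
next
  case False
  then obtain w where w: "awalk s w t" "x = ereal (path_cost w $ i)"
    using walk by blast
  let ?q = "awalk_to_apath w"
  have "awalk_cost (\<lambda>e. cost e $ i) c \<ge> 0" if "awalk u c u" for u c
    using that cost_nonneg by (rule pos_cost_pos_awalk_cost)
  then have "path_cost ?q $ i \<le> path_cost w $ i"
    unfolding path_cost_def
    using awalk_to_path_no_neg_cyc_cost[OF w(1), of "\<lambda>e. cost e $ i"] by (fastforce simp: not_less)
  moreover have q: "apath s ?q t"
    using w(1) by (rule apath_awalk_to_apath)
  ultimately have "path_cost ?q $ i = path_cost w $ i"
    using le[of ?q] w(2) by (auto simp: apath_def)
  then have "Min ((\<lambda>p. path_cost p $ i) ` {p. apath s p t}) = path_cost w $ i"
    using q le w(2) apaths_finite[of s t] by (intro Min_eqI) (auto simp: apath_def image_iff)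
  then show ?thesis
    using q w(2) by (auto simp: shortest_path_cost_def)
qed

section \<open>The invariant of the main loop\<close>

lemma follows_awalk:
  assumes "follows f m t p" and "t \<in> pverts G"
    and "\<And>m e. f m = Some e \<Longrightarrow> e \<in> parcs G \<and> fst e = m"
  shows "awalk m p t"
  using assms(1,2)
proof induction
  case (reached t)
  then show ?case by (simp add: awalk_Nil_iff)
next
  case (follow_edge m t e p)
  then show ?case using assms(3)[of m e] by (auto simp: awalk_Cons_iff)
qed

text \<open>Both alternatives outlast later iterations that leave \<open>lb n\<close> unchanged:
  dominance by \<open>P\<close> persists, and the entries \<open>lb m\<close> only decrease.\<close>

definition settled :: "('v \<times> 'v) list set \<Rightarrow> ('v \<Rightarrow> ereal ^ 'd) \<Rightarrow> 'v \<Rightarrow> bool" where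
  "settled P lb n \<longleftrightarrow> set_dominates P (lb n) \<or>
     (\<forall>m i. (m, n) \<in> parcs G \<longrightarrow> lb m $ i \<le> lb n $ i + ereal (cost (m, n) $ i))"

text \<open>Only walks are claimed, as prepending an edge may revisit a node. Successor edges are
  tied to their node but not to the values of \<open>pp_lb\<close>. Finiteness of the path set later
  provides minimal elements.\<close>

definition pp_inv :: "'v \<Rightarrow> 'v \<Rightarrow> ('v, 'd) pp_state \<Rightarrow> bool" where
  "pp_inv s t \<sigma> \<longleftrightarrow>
     (\<forall>i. pp_lb \<sigma> t $ i \<le> 0) \<and>
     (\<forall>n i. pp_lb \<sigma> n $ i = \<infinity> \<or>
        (\<exists>w. awalk n w t \<and> pp_lb \<sigma> n $ i = ereal (path_cost w $ i))) \<and>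
     (\<forall>i m e. pp_succ \<sigma> i m = Some e \<longrightarrow> e \<in> parcs G \<and> fst e = m) \<and>
     finite (pp_paths \<sigma>) \<and> (\<forall>p\<in>pp_paths \<sigma>. awalk s p t) \<and>
     (\<forall>n. n \<notin> pp_open \<sigma> \<longrightarrow> settled (pp_paths \<sigma>) (pp_lb \<sigma>) n)"

lemma pp_inv_init:
  assumes "t \<in> pverts G"
  shows "pp_inv s t (pp_init t)"
  using assms
  by (auto simp: pp_inv_def pp_init_def settled_def awalk_Nil_iff intro!: exI[of _ "[]"])

lemma pp_inv_prune:
  assumes "pp_inv s t \<sigma>" and "set_dominates (pp_paths \<sigma>) (pp_lb \<sigma> n)"
  shows "pp_inv s t (remove_open n \<sigma>)"
  using assms by (auto simp: pp_inv_def remove_open_def settled_def)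

lemma pp_inv_expand:
  assumes inv: "pp_inv s t \<sigma>" and t: "t \<in> pverts G"
    and \<sigma>': "\<sigma>' = relax n (remove_open n \<sigma>)"
    and ps: "list_all2 (\<lambda>i p. follows (pp_succ \<sigma>' i) s t p) is ps"
  shows "pp_inv s t (\<sigma>'\<lparr> pp_paths := fold add_path ps (pp_paths \<sigma>') \<rparr>)"
proof -
  let ?imp = "improves (remove_open n \<sigma>) n"
  let ?P = "fold add_path ps (pp_paths \<sigma>)"
  have imp: "?imp m i \<longleftrightarrow>
      (m, n) \<in> parcs G \<and> pp_lb \<sigma> n $ i + ereal (cost (m, n) $ i) < pp_lb \<sigma> m $ i" for m i
    by (simp add: improves_def remove_open_def)
  have lb': "pp_lb \<sigma>' m $ i =
      (if ?imp m i then pp_lb \<sigma> n $ i + ereal (cost (m, n) $ i) else pp_lb \<sigma> m $ i)" for m i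
    by (simp add: \<sigma>' relax_def remove_open_def)
  have lb'_le: "pp_lb \<sigma>' m $ i \<le> pp_lb \<sigma> m $ i" for m i
    by (auto simp: lb' imp)
  have succ': "pp_succ \<sigma>' i m = (if ?imp m i then Some (m, n) else pp_succ \<sigma> i m)" for m i
    by (simp add: \<sigma>' relax_def remove_open_def)
  have open': "pp_open \<sigma>' = pp_open \<sigma> - {n} \<union> {m. \<exists>i. ?imp m i}"
    by (simp add: \<sigma>' relax_def remove_open_def)
  have paths': "pp_paths \<sigma>' = pp_paths \<sigma>"
    by (simp add: \<sigma>' relax_def remove_open_def)

  have top: "pp_lb \<sigma>' t $ i \<le> 0" for i
    using inv lb'_le[of t i] order_trans unfolding pp_inv_def by blast
  have walk: "pp_lb \<sigma>' m $ i = \<infinity> \<or>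
      (\<exists>w. awalk m w t \<and> pp_lb \<sigma>' m $ i = ereal (path_cost w $ i))" for m i
  proof (cases "?imp m i")
    case True
    then have "pp_lb \<sigma> n $ i \<noteq> \<infinity>"
      by (auto simp: imp)
    then obtain w where "awalk n w t" "pp_lb \<sigma> n $ i = ereal (path_cost w $ i)"
      using inv unfolding pp_inv_def by blast
    then have "awalk m ((m, n) # w) t"
      "pp_lb \<sigma>' m $ i = ereal (path_cost ((m, n) # w) $ i)"
      using True by (auto simp: awalk_Cons_iff imp lb' add.commute)
    then show ?thesis by blast
  next
    case False
    then show ?thesis using inv by (simp add: lb' pp_inv_def)
  qed
  have succ: "e \<in> parcs G \<and> fst e = m" if "pp_succ \<sigma>' i m = Some e" for i m e
  proof (cases "?imp m i")
    case True
    then show ?thesis using that by (auto simp: succ' imp)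
  next
    case False
    then have "pp_succ \<sigma> i m = Some e"
      using that by (simp add: succ')
    then show ?thesis using inv unfolding pp_inv_def by blast
  qed
  have "\<forall>p\<in>set ps. awalk s p t"
    using ps follows_awalk[OF _ t succ] by (fastforce simp: list_all2_conv_all_nth in_set_conv_nth)
  then have paths: "\<forall>p\<in>?P. awalk s p t"
    using fold_add_path_subset[of ps "pp_paths \<sigma>"] inv by (auto simp: pp_inv_def)
  have fin: "finite ?P"
    using fold_add_path_subset[of ps "pp_paths \<sigma>"] inv finite_subset by (fastforce simp: pp_inv_def)
  have settled: "settled ?P (pp_lb \<sigma>') m" if m: "m \<notin> pp_open \<sigma>'" for m
  proof -
    \<comment> \<open>A node outside the new \<open>open\<close> had no entry improved; for
      \<open>n\<close> itself this concerns a possible loop at \<open>n\<close>.\<close>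
    from m have no_imp: "\<not> ?imp m i" for i
      by (auto simp: open')
    then have lb_m: "pp_lb \<sigma>' m = pp_lb \<sigma> m"
      by (simp add: vec_eq_iff lb')
    show ?thesis
    proof (cases "m = n")
      \<comment> \<open>The expansion has just relaxed every edge into \<open>n\<close> and left
        \<open>lb n\<close> unchanged.\<close>
      case True
      then show ?thesis
        unfolding settled_def lb_m by (auto simp: lb' imp)
    next
      case False
      then have "settled (pp_paths \<sigma>) (pp_lb \<sigma>) m"
        using m inv by (auto simp: open' pp_inv_def)
      then show ?thesis
        unfolding settled_def lb_m using set_dominates_fold_add_path lb'_le order_trans by meson
    qed
  qed
  show ?thesis
    using top walk succ paths fin settled by (simp add: pp_inv_def paths')
qed

lemma pp_inv_reachable:
  assumes "(pp_step s t)\<^sup>*\<^sup>* (pp_init t) \<sigma>" and "t \<in> pverts G"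
  shows "pp_inv s t \<sigma>"
  using assms(1)
proof induction
  case base
  then show ?case using pp_inv_init assms(2) by blast
next
  case (step \<sigma> \<sigma>')
  from step.hyps(2) step.IH show ?case
    by cases (use pp_inv_prune pp_inv_expand assms(2) in blast)+
qed

section \<open>Bounds along walks through settled nodes\<close>

lemma settled_lb_le_or_dominated:
  assumes "\<And>n. settled P lb n" and "\<And>i. lb t $ i \<le> 0" and "awalk n w t"
  shows "(\<forall>i. lb n $ i \<le> ereal (path_cost w $ i)) \<or> (\<exists>q\<in>P. path_cost q < path_cost w)"
  using assms(3)
proof (induction w arbitrary: n)
  case Nil
  then show ?case using assms(2) by (auto simp: awalk_Nil_iff zero_ereal_def)
next
  case (Cons e w)
  obtain m where e: "e = (n, m)" "(n, m) \<in> parcs G" "awalk m w t"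
    using Cons.prems by (cases e) (auto simp: awalk_Cons_iff)
  \<comment> \<open>Prepending an edge lowers no cost, so a path in \<open>P\<close> that dominates
    the tail \<open>w\<close> also dominates the whole walk.\<close>
  have le: "path_cost w \<le> path_cost (e # w)"
    using cost_nonneg e by (auto simp: less_eq_vec_def)
  consider (dom) q where "q \<in> P" "path_cost q < path_cost w"
    | (pruned) q where "\<forall>i. lb m $ i \<le> ereal (path_cost w $ i)"
        "q \<in> P" "(\<chi> i. ereal (path_cost q $ i)) < lb m"
    | (relaxed) "\<forall>i. lb m $ i \<le> ereal (path_cost w $ i)"
        "\<forall>i. lb n $ i \<le> lb m $ i + ereal (cost (n, m) $ i)"
    using Cons.IH[OF e(3)] assms(1)[of m] e(2) unfolding settled_def set_dominates_iff by blast
  then show ?case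
  proof cases
    case dom
    then show ?thesis using le less_le_trans by blast
  next
    case pruned
    \<comment> \<open>As \<open>lb m\<close> is at most the cost of the tail in all criteria,
      whatever dominates \<open>lb m\<close> dominates the tail.\<close>
    then have "(\<chi> i. ereal (path_cost q $ i)) < (\<chi> i. ereal (path_cost w $ i))"
      by (intro less_le_trans[OF pruned(3)]) (simp add: less_eq_vec_def)
    then have "path_cost q < path_cost w"
      by (simp add: less_vec_def less_eq_vec_def)
    then show ?thesis using pruned(2) le less_le_trans by blast
  next
    case relaxed
    have "lb n $ i \<le> ereal (path_cost (e # w) $ i)" for i
    proof -
      have "lb n $ i \<le> lb m $ i + ereal (cost (n, m) $ i)"
        using relaxed by blast
      also have "\<dots> \<le> ereal (path_cost w $ i) + ereal (cost (n, m) $ i)"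
        using relaxed by (intro add_right_mono) blast
      finally show ?thesis by (simp add: e add.commute)
    qed
    then show ?thesis by blast
  qed
qed

text \<open>In a single criterion, dominance yields only a weak inequality. A pruned node therefore
  supplies a member of \<open>P\<close> that is no more expensive than the walk in \<open>i\<close>,
  to which the bound for all criteria can then be related.\<close>

lemma settled_component_le_or_path_le:
  assumes "\<And>n. settled P lb n" and "lb t $ i \<le> 0" and "awalk n w t"
  shows "lb n $ i \<le> ereal (path_cost w $ i) \<or> (\<exists>q\<in>P. path_cost q $ i \<le> path_cost w $ i)"
  using assms(3)
proof (induction w arbitrary: n)
  case Nil
  then show ?case using assms(2) by (auto simp: awalk_Nil_iff zero_ereal_def)
next
  case (Cons e w)
  obtain m where e: "e = (n, m)" "(n, m) \<in> parcs G" "awalk m w t"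
    using Cons.prems by (cases e) (auto simp: awalk_Cons_iff)
  have le: "path_cost w $ i \<le> path_cost (e # w) $ i"
    using cost_nonneg e by auto
  consider (path) q where "q \<in> P" "path_cost q $ i \<le> path_cost w $ i"
    | (pruned) q where "lb m $ i \<le> ereal (path_cost w $ i)"
        "q \<in> P" "(\<chi> i. ereal (path_cost q $ i)) < lb m"
    | (relaxed) "lb m $ i \<le> ereal (path_cost w $ i)"
        "lb n $ i \<le> lb m $ i + ereal (cost (n, m) $ i)"
    using Cons.IH[OF e(3)] assms(1)[of m] e(2) unfolding settled_def set_dominates_iff by blast
  then show ?case
  proof cases
    case path
    then show ?thesis using le order_trans by blast
  next
    case pruned
    then have "ereal (path_cost q $ i) \<le> lb m $ i"
      by (simp add: less_vec_def less_eq_vec_def)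
    then have "path_cost q $ i \<le> path_cost w $ i"
      using pruned(1) order_trans ereal_less_eq(3) by blast
    then show ?thesis using pruned(2) le order_trans by blast
  next
    case relaxed
    note relaxed(2)
    also have "lb m $ i + ereal (cost (n, m) $ i)
        \<le> ereal (path_cost w $ i) + ereal (cost (n, m) $ i)"
      using relaxed(1) by (intro add_right_mono)
    finally show ?thesis by (simp add: e add.commute)
  qed
qed

lemma settled_lb_le_path_cost:
  assumes settled: "\<And>n. settled P lb n" and top: "\<And>i. lb t $ i \<le> 0"
    and P: "finite P" "\<And>p. p \<in> P \<Longrightarrow> awalk s p t"
    and "awalk s w t"
  shows "lb s $ i \<le> ereal (path_cost w $ i)"
  using settled_component_le_or_path_le[OF settled top \<open>awalk s w t\<close>, of i]
proof
  assume "\<exists>q\<in>P. path_cost q $ i \<le> path_cost w $ i"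
  then obtain q where q: "q \<in> P" "path_cost q $ i \<le> path_cost w $ i"
    by blast
  \<comment> \<open>The path \<open>q\<close> may itself be dominated within \<open>P\<close>, since
    \<open>add_path\<close> never rejects the new path; a minimal \<open>r\<close> below
    \<open>q\<close> is not, so the bound for all criteria applies to the walk
    \<open>r\<close>.\<close>
  obtain r where r: "r \<in> P" "path_cost r \<le> path_cost q"
    and min: "\<And>p. p \<in> P \<Longrightarrow> path_cost p \<le> path_cost r \<Longrightarrow> path_cost r = path_cost p"
    using finite_has_minimal2[of "path_cost ` P" "path_cost q"] P(1) q(1) by auto
  have "\<not> (\<exists>p\<in>P. path_cost p < path_cost r)"
    using min by (fastforce simp: less_le)
  then have "lb s $ i \<le> ereal (path_cost r $ i)"
    using settled_lb_le_or_dominated[OF settled top P(2)[OF r(1)]] by blast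
  also have "path_cost r $ i \<le> path_cost w $ i"
    using r(2) q(2) order_trans unfolding less_eq_vec_def by blast
  finally show ?thesis by simp
qed

section \<open>The values upon termination\<close>

lemma ParetoPrep_lb_eq_shortest_path_cost:
  assumes "ParetoPrep s t P lb" and "t \<in> pverts G"
  shows "lb s $ i = shortest_path_cost s t i"
proof -
  obtain \<sigma> where \<sigma>: "(pp_step s t)\<^sup>*\<^sup>* (pp_init t) \<sigma>" "pp_open \<sigma> = {}" "lb = pp_lb \<sigma>"
    using assms(1) by (auto simp: ParetoPrep_def)
  have inv: "pp_inv s t \<sigma>"
    using \<sigma>(1) assms(2) by (rule pp_inv_reachable)
  show ?thesis
  proof (rule shortest_path_cost_eqI)
    show "lb s $ i = \<infinity> \<or> (\<exists>w. awalk s w t \<and> lb s $ i = ereal (path_cost w $ i))"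
      using inv unfolding pp_inv_def \<sigma>(3) by blast
    \<comment> \<open>With \<open>open\<close> empty, the invariant makes every node
      settled.\<close>
    show "lb s $ i \<le> ereal (path_cost w $ i)" if "awalk s w t" for w
      using inv \<sigma>(2) that settled_lb_le_path_cost[of "pp_paths \<sigma>" lb t s w i]
      by (simp add: pp_inv_def \<sigma>(3))
  qed
qed

end

theorem corollary6:
  fixes G :: "'v pair_pre_digraph"
    and cost :: "'v \<times> 'v \<Rightarrow> real ^ 'd"
    and s t :: 'v
    and P :: "('v \<times> 'v) list set"
    and lb :: "'v \<Rightarrow> ereal ^ 'd"
  assumes "multicost_network G cost"
    and "s \<in> pverts G" and "t \<in> pverts G"
    and "multicost_network.ParetoPrep G cost s t P lb"
  shows "\<forall>i. lb s $ i = multicost_network.shortest_path_cost G cost s t i"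
  using multicost_network.ParetoPrep_lb_eq_shortest_path_cost[OF assms(1,4,3)] by blast

end
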